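(* (Bipartite case.) Consider a min-entropy source with an observed min-entropy $H_{\min}(\mathbf{XY})=N\log(m_Am_B)$ for an $N$-run bipartite Bell test with $m_A>1$ inputs on Alice, $m_B>1$ inputs on Bob and arbitrary alphabets for the outcomes. If $$H_{\min}(\mathbf{XY}|\mathbf{\Lambda})\le N\log(m_A+m_B-1),$$ then no conclusion can be drawn from the Bell test, since the no-signaling limit of the inequality can be reached with local distributions. (Multipartite case.) The generalization to $K$-partite Bell tests with $m_k>1$ inputs for party $k$ ($k=1,\dots,K$) is as follows. For a min-entropy source with observed min-entropy $H_{\min}(\mathbf{Z_1\dots Z_K})=N\log\big(\prod_{k=1}^K m_k\big)$, if $$H_{\min}(\mathbf{Z_1\dots Z_K}|\mathbf{\Lambda})\le N\log\Big(\sum_{k=1}^K m_k-K+1\Big),$$ then no conclusion can be drawn from the Bell test, since the no-signaling limit of the inequality can be reached with local distributions. In particular, without further assumptions, any source of randomness with $H_{\min}(\mathbf{XY}|\mathbf{\Lambda})\le N\log 3$ is useless as a source for any Bell test.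
   Context: **Scenario.** In a $K$-partite Bell test with $N$ runs, in each run party $i$ receives a setting (input) $z_i\in\{1,\dots,m_i\}$ and produces an outcome $o_i$. Write $\mathbf z=(z_1,\dots,z_K)$ and $\mathbf o=(o_1,\dots,o_K)$. The bipartite case is $K=2$, with $\mathbf z=(x,y)$, $\mathbf o=(a,b)$, $m_1=m_A$, $m_2=m_B$. A distribution $P(\mathbf o|\mathbf z)$ is *no-signaling* if for every subset of parties the marginal distribution of their outcomes depends only on their own settings. It is *local* if it is a convex combination of products $\prod_{i=1}^K p_i(o_i|z_i)$ of conditional probability distributions. **Bell inequality.** A Bell inequality bounds a linear combination $B$ of the probabilities $P(\mathbf o|\mathbf z)$ over local distributions. Its no-signaling limit is the maximal value of $B$ over no-signaling distributions. **Source and min-entropy.** The source is the random variable giving the settings of all $N$ runs, denoted $\mathbf{XY}$ in the bipartite case and $\mathbf{Z_1\dots Z_K}$ in the $K$-partite case. The classical random variable $\mathbf\Lambda$ is the information present in the boxes of the parties, which may be correlated with the settings. For random variables $\mathbf Z,\mathbf\Lambda$, $$H_{\min}(\mathbf Z|\mathbf\Lambda)=-\log\sum_\lambda P(\mathbf\Lambda=\lambda)\max_{\mathbf w}P(\mathbf Z=\mathbf w|\mathbf\Lambda=\lambda),\qquad H_{\min}(\mathbf Z)=-\log\max_{\mathbf w}P(\mathbf Z=\mathbf w),$$ with logarithms in base 2. The source is characterized only by its min-entropy: $\mathbf Z$ is a $k$-min-entropy source with respect to $\mathbf\Lambda$ if $H_{\min}(\mathbf Z|\mathbf\Lambda)\ge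 k$, with no further structure assumed. The observed min-entropy is $H_{\min}(\mathbf Z)$, the min-entropy of the settings for someone without access to $\mathbf\Lambda$. The condition that it equals $N\log\prod_k m_k$ says that the observed settings are uniformly distributed. **Reaching a value with local distributions.** If, in a given run, the boxes respond according to the distribution $P_\lambda(\mathbf o|\mathbf z)$ when $\mathbf\Lambda=\lambda$, the observed statistics of that run are $\sum_\lambda p(\lambda|\mathbf z)P_\lambda(\mathbf o|\mathbf z)$, where $p(\lambda|\mathbf z)$ is the probability of $\lambda$ given the settings $\mathbf z$ of that run. A value of $B$ is reached with local distributions if the observed statistics attain it with every $P_\lambda$ local. "No conclusion can be drawn", and the source being "useless", mean that the violation of the inequality then does not allow one to conclude that the boxes are not described by local distributions. *)

theory Defs
  imports "HOL-Probability.Probability"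
begin

text \<open>
  Parties are \<open>1, \<dots>, K\<close>, runs are \<open>1, \<dots>, N\<close>, and the settings of party \<open>i\<close> are \<open>1, \<dots>, m i\<close>.
  Tuples are functions that are \<open>undefined\<close> off their index set.  The outcome alphabet \<open>A i\<close> of
  party \<open>i\<close> is an arbitrary nonempty set, not necessarily finite.
\<close>

type_synonym setting = "nat \<Rightarrow> nat"
type_synonym 'o outcome = "nat \<Rightarrow> 'o"
type_synonym 'o behaviour = "setting \<Rightarrow> 'o outcome pmf"

text \<open>The joint law of the settings of all runs (a function of the run) and of \<open>\<Lambda>\<close>:\<close>
type_synonym 'l source = "((nat \<Rightarrow> setting) \<times> 'l) pmf"


subsection \<open>No-signaling and local distributions\<close>

definition settings :: "nat \<Rightarrow> (nat \<Rightarrow> nat) \<Rightarrow> setting set" where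
  "settings K m = (\<Pi>\<^sub>E i\<in>{1..K}. {1..m i})"

definition outcomes :: "nat \<Rightarrow> (nat \<Rightarrow> 'o set) \<Rightarrow> 'o outcome set" where
  "outcomes K A = (\<Pi>\<^sub>E i\<in>{1..K}. A i)"

definition is_behaviour :: "nat \<Rightarrow> (nat \<Rightarrow> nat) \<Rightarrow> (nat \<Rightarrow> 'o set) \<Rightarrow> 'o behaviour \<Rightarrow> bool" where
  "is_behaviour K m A P \<longleftrightarrow> (\<forall>z\<in>settings K m. set_pmf (P z) \<subseteq> outcomes K A)"

definition no_signaling :: "nat \<Rightarrow> (nat \<Rightarrow> nat) \<Rightarrow> (nat \<Rightarrow> 'o set) \<Rightarrow> 'o behaviour \<Rightarrow> bool" where
  "no_signaling K m A P \<longleftrightarrow> is_behaviour K m A P \<and>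
     (\<forall>S\<subseteq>{1..K}. \<forall>z\<in>settings K m. \<forall>z'\<in>settings K m. (\<forall>i\<in>S. z i = z' i) \<longrightarrow>
        map_pmf (\<lambda>out. restrict out S) (P z) = map_pmf (\<lambda>out. restrict out S) (P z'))"

definition local_dist :: "nat \<Rightarrow> (nat \<Rightarrow> nat) \<Rightarrow> (nat \<Rightarrow> 'o set) \<Rightarrow> 'o behaviour \<Rightarrow> bool" where
  "local_dist K m A P \<longleftrightarrow> is_behaviour K m A P \<and>
     (\<exists>(n::nat) (w :: nat \<Rightarrow> real) (p :: nat \<Rightarrow> nat \<Rightarrow> nat \<Rightarrow> 'o pmf).
        (\<forall>j<n. 0 \<le> w j) \<and> (\<Sum>j<n. w j) = 1 \<and>
        (\<forall>j<n. \<forall>i\<in>{1..K}. \<forall>s\<in>{1..m i}. set_pmf (p j i s) \<subseteq> A i) \<and>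
        (\<forall>z\<in>settings K m. \<forall>out\<in>outcomes K A.
           pmf (P z) out = (\<Sum>j<n. w j * (\<Prod>i\<in>{1..K}. pmf (p j i (z i)) (out i)))))"


subsection \<open>Bell expressions\<close>

text \<open>
  A Bell expression is a (finite) linear combination of the probabilities, with coefficients
  \<open>\<beta> z out\<close>.  The finiteness condition is automatic for finite alphabets.
\<close>

definition bell_coeffs :: "nat \<Rightarrow> (nat \<Rightarrow> nat) \<Rightarrow> (nat \<Rightarrow> 'o set) \<Rightarrow> (setting \<Rightarrow> 'o outcome \<Rightarrow> real) \<Rightarrow> bool" where
  "bell_coeffs K m A \<beta> \<longleftrightarrow> (\<forall>z\<in>settings K m. finite {out \<in> outcomes K A. \<beta> z out \<noteq> 0})"

definition bell_value ::
    "nat \<Rightarrow> (nat \<Rightarrow> nat) \<Rightarrow> (nat \<Rightarrow> 'o set) \<Rightarrow> (setting \<Rightarrow> 'o outcome \<Rightarrow> real) \<Rightarrow> 'o behaviour \<Rightarrow> real" where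
  "bell_value K m A \<beta> P =
     (\<Sum>z\<in>settings K m. \<Sum>out\<in>{out \<in> outcomes K A. \<beta> z out \<noteq> 0}. \<beta> z out * pmf (P z) out)"

definition is_ns_limit ::
    "nat \<Rightarrow> (nat \<Rightarrow> nat) \<Rightarrow> (nat \<Rightarrow> 'o set) \<Rightarrow> (setting \<Rightarrow> 'o outcome \<Rightarrow> real) \<Rightarrow> real \<Rightarrow> bool" where
  "is_ns_limit K m A \<beta> v \<longleftrightarrow>
     (\<exists>P. no_signaling K m A P \<and> bell_value K m A \<beta> P = v) \<and>
     (\<forall>P. no_signaling K m A P \<longrightarrow> bell_value K m A \<beta> P \<le> v)"


subsection \<open>Sources and min-entropy\<close>

definition is_source :: "nat \<Rightarrow> (nat \<Rightarrow> nat) \<Rightarrow> nat \<Rightarrow> 'l source \<Rightarrow> bool" where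
  "is_source K m N J \<longleftrightarrow> set_pmf (map_pmf fst J) \<subseteq> (\<Pi>\<^sub>E n\<in>{1..N}. settings K m)"

text \<open>The suprema below are maxima, since the values of a \<open>pmf\<close> are summable.\<close>

definition min_entropy :: "'a pmf \<Rightarrow> real" where
  "min_entropy X = - log 2 (SUP w. pmf X w)"

definition cond_min_entropy :: "('a \<times> 'l) pmf \<Rightarrow> real" where
  "cond_min_entropy J =
     - log 2 (\<Sum>\<^sub>\<infinity>l. pmf (map_pmf snd J) l * (SUP w. pmf J (w, l) / pmf (map_pmf snd J) l))"


subsection \<open>Reaching a value with local distributions\<close>

text \<open>
  The observed statistics \<open>\<Sum>\<^sub>\<lambda> p(\<lambda>|z) R\<^sub>\<lambda>(out|z)\<close> of run \<open>n\<close> with responses \<open>R\<close>.  They are meaningful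
  when the setting \<open>z\<close> has positive probability in run \<open>n\<close>, as for uniform observed settings.
\<close>

definition observed :: "'l source \<Rightarrow> nat \<Rightarrow> ('l \<Rightarrow> 'o behaviour) \<Rightarrow> 'o behaviour" where
  "observed J n R z = bind_pmf (map_pmf snd (cond_pmf J {x. fst x n = z})) (\<lambda>l. R l z)"

definition locally_reached ::
    "nat \<Rightarrow> (nat \<Rightarrow> nat) \<Rightarrow> (nat \<Rightarrow> 'o set) \<Rightarrow> (setting \<Rightarrow> 'o outcome \<Rightarrow> real) \<Rightarrow> 'l source \<Rightarrow> nat \<Rightarrow> real \<Rightarrow> bool" where
  "locally_reached K m A \<beta> J n v \<longleftrightarrow>
     (\<exists>R. (\<forall>l. local_dist K m A (R l)) \<and> bell_value K m A \<beta> (observed J n R) = v)"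

text \<open>
  A source is characterized only by its observed min-entropy \<open>h_obs\<close> and its conditional
  min-entropy \<open>h\<close>.  No conclusion can be drawn from the Bell test if some source with exactly
  these min-entropies lets local distributions reach, in every run, the no-signaling limit of every
  Bell expression.  The type argument is the type of the outcomes; it occurs only under the
  quantifiers over \<open>A\<close> and \<open>\<beta>\<close>.  Taking \<open>\<Lambda>\<close> to be \<open>nat\<close>-valued only restricts the choice of source.
\<close>

definition no_conclusion ::
    "nat \<Rightarrow> (nat \<Rightarrow> nat) \<Rightarrow> nat \<Rightarrow> 'o itself \<Rightarrow> real \<Rightarrow> real \<Rightarrow> bool" where
  "no_conclusion K m N (_ :: 'o itself) h_obs h \<longleftrightarrow>
     (\<exists>J :: nat source.
        is_source K m N J \<and> min_entropy (map_pmf fst J) = h_obs \<and> cond_min_entropy J = h \<and>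
        (\<forall>(A :: nat \<Rightarrow> 'o set) \<beta>.
           (\<forall>i\<in>{1..K}. A i \<noteq> {}) \<and> bell_coeffs K m A \<beta> \<longrightarrow>
           (\<exists>v. is_ns_limit K m A \<beta> v \<and> (\<forall>n\<in>{1..N}. locally_reached K m A \<beta> J n v))))"

definition bipartite :: "nat \<Rightarrow> nat \<Rightarrow> nat \<Rightarrow> nat" where
  "bipartite mA mB i = (if i = 1 then mA else mB)"

end

theory Submission
  imports Defs
begin

text \<open>
  Fix a base setting \<open>b\<close> and call its star the \<open>\<Sum> m i - K + 1\<close> settings that differ from \<open>b\<close> for at
  most one party.  Every no-signaling behaviour \<open>P\<close> agrees on the star with a local one: draw \<open>a\<close> from
  \<open>P b\<close>; party \<open>i\<close> answers \<open>a i\<close> on the setting \<open>b i\<close>, and on any other setting draws an answer from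
  \<open>P\<close> conditioned on the outcomes of the others being those of \<open>a\<close>.  This has the right law since,
  by no-signaling, the outcomes of the others have the same marginal at all these settings.

  So let \<open>\<Lambda>\<close> consist of one base setting per run, uniformly distributed, and let the settings be
  uniform in the corresponding stars.  The star relation is symmetric and all stars have the same
  size, so the observed settings are uniform, while the conditional min-entropy is
  \<open>N log (\<Sum> m i - K + 1)\<close>.  Smaller values are obtained by letting \<open>\<Lambda>\<close> reveal all settings
  with a suitable probability.

  The no-signaling limit is attained, at a behaviour of finite support: outcomes on which the Bell
  expression does not depend can be merged into one per party, which leaves finite alphabets and
  hence a compact set of no-signaling behaviours.
\<close>

subsection \<open>Stars of settings and their local models\<close>

lemma finite_settings [simp]: "finite (settings K m)"
  by (simp add: settings_def finite_PiE)

lemma settings_mem: "z \<in> settings K m \<Longrightarrow> i \<in> {1..K} \<Longrightarrow> z i \<in> {1..m i}"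
  unfolding settings_def by (rule PiE_mem)

lemma settings_arb: "z \<in> settings K m \<Longrightarrow> i \<notin> {1..K} \<Longrightarrow> z i = undefined"
  unfolding settings_def by (rule PiE_arb)

text \<open>The Hamming ball of radius 1. Saying that any two differing coordinates coincide makes
  symmetry immediate. Letting \<open>i\<close> and \<open>j\<close> range over all naturals is
  harmless, since settings are \<open>undefined\<close> off \<open>{1..K}\<close>.\<close>

definition star :: "nat \<Rightarrow> (nat \<Rightarrow> nat) \<Rightarrow> setting \<Rightarrow> setting set" where
  "star K m b = {z \<in> settings K m. \<forall>i j. z i \<noteq> b i \<longrightarrow> z j \<noteq> b j \<longrightarrow> i = j}"

lemma star_subset: "star K m b \<subseteq> settings K m"
  by (auto simp: star_def)

lemma self_in_star: "b \<in> settings K m \<Longrightarrow> b \<in> star K m b"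
  by (auto simp: star_def)

lemma star_sym: "b \<in> settings K m \<Longrightarrow> z \<in> star K m b \<Longrightarrow> b \<in> star K m z"
  unfolding star_def mem_Collect_eq by metis

lemma fun_upd_in_settings:
  "b \<in> settings K m \<Longrightarrow> i \<in> {1..K} \<Longrightarrow> s \<in> {1..m i} \<Longrightarrow> b(i := s) \<in> settings K m"
  unfolding settings_def by (auto simp: PiE_def Pi_def extensional_def)

lemma star_eq:
  assumes b: "b \<in> settings K m"
  shows "star K m b = insert b (\<Union>i\<in>{1..K}. (\<lambda>s. b(i := s)) ` ({1..m i} - {b i}))"
    (is "_ = ?R")
proof (intro equalityI subsetI)
  fix z assume z: "z \<in> star K m b"
  show "z \<in> ?R"
  proof (cases "z = b")
    case False
    then obtain i where i: "z i \<noteq> b i" by blast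
    have eq: "z = b(i := z i)"
    proof
      show "z j = (b(i := z i)) j" for j
        using z i by (cases "j = i") (auto simp: star_def)
    qed
    have zs: "z \<in> settings K m" using z by (simp add: star_def)
    have iK: "i \<in> {1..K}"
      using i settings_arb[OF b, of i] settings_arb[OF zs, of i] by argo
    have "z i \<in> {1..m i} - {b i}"
      using settings_mem[OF zs iK] i by simp
    with iK eq show ?thesis by blast
  qed simp
next
  fix z assume "z \<in> ?R"
  then consider "z = b" | i s where "i \<in> {1..K}" "s \<in> {1..m i}" "z = b(i := s)"
    by blast
  then show "z \<in> star K m b"
  proof cases
    case 1
    then show ?thesis using b by (simp add: self_in_star)
  next
    case 2
    then have "z \<in> settings K m"
      using b fun_upd_in_settings by blast
    then show ?thesis using 2 by (auto simp: star_def split: if_splits)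
  qed
qed

text \<open>The axes through \<open>b\<close> meet only in \<open>b\<close>, and axis
  \<open>i\<close> contributes \<open>m i - 1\<close> further points. The subtraction on naturals is
  exact because \<open>b i\<close> lies in \<open>{1..m i}\<close>.\<close>

lemma card_star:
  assumes b: "b \<in> settings K m"
  shows "card (star K m b) = 1 + (\<Sum>i=1..K. m i - 1)"
proof -
  let ?F = "\<lambda>i. (\<lambda>s. b(i := s)) ` ({1..m i} - {b i})"
  have bi: "b i \<in> {1..m i}" if "i \<in> {1..K}" for i
    by (rule settings_mem[OF b that])
  have card_F: "card (?F i) = m i - 1" if "i \<in> {1..K}" for i
  proof -
    have "inj_on (\<lambda>s. b(i := s)) ({1..m i} - {b i})"
      by (auto simp: inj_on_def dest: fun_upd_eqD)
    then have "card (?F i) = card ({1..m i} - {b i})" by (rule card_image)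
    then show ?thesis using bi[OF that] by simp
  qed
  have disj: "?F i \<inter> ?F j = {}" if "i \<noteq> j" for i j
  proof -
    have "b(i := s) \<noteq> b(j := s')" if "s \<noteq> b i" for s s'
      using that \<open>i \<noteq> j\<close> by (metis fun_upd_def)
    then show ?thesis by blast
  qed
  have "b(i := s) \<noteq> b" if "s \<noteq> b i" for i s
    using that by (metis fun_upd_same)
  then have "b \<notin> (\<Union>i\<in>{1..K}. ?F i)"
    by (metis (no_types, lifting) DiffE UN_E imageE insertI1)
  moreover have "card (\<Union>i\<in>{1..K}. ?F i) = (\<Sum>i=1..K. card (?F i))"
    by (rule card_UN_disjoint) (use disj in auto)
  ultimately show ?thesis
    using card_F by (simp add: star_eq[OF b])
qed

section \<open>The local model on a star\<close>

definition response ::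
    "nat \<Rightarrow> 'o behaviour \<Rightarrow> setting \<Rightarrow> 'o outcome \<Rightarrow> nat \<Rightarrow> nat \<Rightarrow> 'o pmf" where
  "response K P b a i s =
     (if s = b i then return_pmf (a i)
      else map_pmf (\<lambda>x. x i)
        (cond_pmf (P (b(i := s))) {x. restrict x ({1..K} - {i}) = restrict a ({1..K} - {i})}))"

definition star_model :: "nat \<Rightarrow> 'o behaviour \<Rightarrow> setting \<Rightarrow> 'o behaviour" where
  "star_model K P b z =
     bind_pmf (P b) (\<lambda>a. Pi_pmf {1..K} undefined (\<lambda>i. response K P b a i (z i)))"

lemma no_signaling_marginal:
  assumes "no_signaling K m A P" "z \<in> settings K m" "z' \<in> settings K m" "S \<subseteq> {1..K}"
    and "\<And>i. i \<in> S \<Longrightarrow> z i = z' i"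
  shows "map_pmf (\<lambda>x. restrict x S) (P z) = map_pmf (\<lambda>x. restrict x S) (P z')"
  using assms unfolding no_signaling_def by blast

lemma no_signaling_outcomes:
  "no_signaling K m A P \<Longrightarrow> z \<in> settings K m \<Longrightarrow> x \<in> set_pmf (P z) \<Longrightarrow> x \<in> outcomes K A"
  unfolding no_signaling_def is_behaviour_def by blast

lemma no_signaling_mem:
  assumes "no_signaling K m A P" "z \<in> settings K m" "x \<in> set_pmf (P z)" "i \<in> {1..K}"
  shows "x i \<in> A i"
  using no_signaling_outcomes[OF assms(1), OF assms(2,3)] assms(4) unfolding outcomes_def by blast

lemma no_signaling_arb:
  assumes "no_signaling K m A P" "z \<in> settings K m" "x \<in> set_pmf (P z)" "i \<notin> {1..K}"
  shows "x i = undefined"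
  using no_signaling_outcomes[OF assms(1), OF assms(2,3)] assms(4) unfolding outcomes_def by blast

text \<open>By no-signaling the parties other than \<open>i\<close> produce their part of
  \<open>a\<close> with positive probability at \<open>b(i := s)\<close> as well. This makes the
  \<open>cond_pmf\<close> in \<open>response\<close> a genuine conditional law.\<close>

lemma cond_event_nonempty:
  assumes ns: "no_signaling K m A P" and b: "b \<in> settings K m" and i: "i \<in> {1..K}"
    and s: "s \<in> {1..m i}" and a: "a \<in> set_pmf (P b)"
  shows "set_pmf (P (b(i := s))) \<inter> {x. restrict x ({1..K} - {i}) = restrict a ({1..K} - {i})} \<noteq> {}"
proof -
  let ?r = "\<lambda>x. restrict x ({1..K} - {i})"
  have "map_pmf ?r (P b) = map_pmf ?r (P (b(i := s)))"
    by (rule no_signaling_marginal[OF ns, OF b fun_upd_in_settings[OF b i s]]) auto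
  then have "?r a \<in> set_pmf (map_pmf ?r (P (b(i := s))))"
    using a by (metis image_eqI set_map_pmf)
  then show ?thesis by fastforce
qed

lemma set_response:
  assumes ns: "no_signaling K m A P" and b: "b \<in> settings K m" and i: "i \<in> {1..K}"
    and s: "s \<in> {1..m i}" and a: "a \<in> set_pmf (P b)"
  shows "set_pmf (response K P b a i s) \<subseteq> A i"
proof -
  let ?C = "cond_pmf (P (b(i := s))) {x. restrict x ({1..K} - {i}) = restrict a ({1..K} - {i})}"
  have "set_pmf ?C \<subseteq> set_pmf (P (b(i := s)))"
    unfolding set_cond_pmf[OF cond_event_nonempty[OF ns, OF b i s a]] by blast
  then have "x i \<in> A i" if "x \<in> set_pmf ?C" for x
    using that no_signaling_mem[OF ns, OF fun_upd_in_settings[OF b i s] _ i] by blast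
  then show ?thesis
    using no_signaling_mem[OF ns, OF b a i] by (auto simp: response_def simp del: atLeastAtMost_iff)
qed

text \<open>The outcome \<open>a\<close> is shared randomness, given which the parties answer
  independently. Finiteness of its support turns the mixture into the finite convex combination that
  \<open>local_dist\<close> demands, with weights \<open>pmf (P b) a\<close>.\<close>

lemma star_model_local:
  assumes ns: "no_signaling K m A P" and b: "b \<in> settings K m" and fin: "finite (set_pmf (P b))"
  shows "local_dist K m A (star_model K P b)"
proof -
  have set_Pi: "set_pmf (Pi_pmf {1..K} undefined (\<lambda>i. response K P b a i (z i))) \<subseteq> outcomes K A"
    if "z \<in> settings K m" "a \<in> set_pmf (P b)" for z a
  proof -
    have "set_pmf (response K P b a i (z i)) \<subseteq> A i" if i: "i \<in> {1..K}" for i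
    proof (rule set_response[OF ns, OF b i])
      show "z i \<in> {1..m i}" using \<open>z \<in> _\<close> i by (rule settings_mem)
    qed fact
    then have "x \<in> outcomes K A" if "x \<in> PiE_dflt {1..K} undefined (set_pmf \<circ> (\<lambda>i. response K P b a i (z i)))" for x
      using that unfolding PiE_dflt_def outcomes_def by (intro PiE_I) auto
    then show ?thesis by (subst set_Pi_pmf) auto
  qed
  have beh: "is_behaviour K m A (star_model K P b)"
    using set_Pi unfolding is_behaviour_def star_model_def by fastforce
  obtain e where e: "bij_betw e {..<card (set_pmf (P b))} (set_pmf (P b))"
    using fin ex_bij_betw_nat_finite by (auto simp: atLeast0LessThan)
  let ?n = "card (set_pmf (P b))"
  let ?w = "\<lambda>j. pmf (P b) (e j)" and ?p = "\<lambda>j. response K P b (e j)"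
  have e_in: "e j \<in> set_pmf (P b)" if "j < ?n" for j
    using e that by (auto simp: bij_betw_def)
  have sum_w: "(\<Sum>j<?n. ?w j) = 1"
    using sum.reindex_bij_betw[OF e, of "pmf (P b)"] sum_pmf_eq_1[OF fin subset_refl] by simp
  have pmf_eq: "pmf (star_model K P b z) x = (\<Sum>j<?n. ?w j * (\<Prod>i\<in>{1..K}. pmf (?p j i (z i)) (x i)))"
    if "x \<in> outcomes K A" for z x
  proof -
    \<comment> \<open>\<open>pmf_Pi\<close> yields the product of the factors only for tuples that
      take the default value off the index set.\<close>
    have x: "x i = undefined" if "i \<notin> {1..K}" for i
      using \<open>x \<in> _\<close> that unfolding outcomes_def by (rule PiE_arb)
    let ?g = "\<lambda>a. \<Prod>i\<in>{1..K}. pmf (response K P b a i (z i)) (x i)"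
    have "pmf (star_model K P b z) x = measure_pmf.expectation (P b) ?g"
      unfolding star_model_def pmf_bind using x by (subst pmf_Pi) auto
    also have "\<dots> = (\<Sum>a\<in>set_pmf (P b). ?g a * pmf (P b) a)"
      by (rule integral_measure_pmf_real[OF fin])
    also have "\<dots> = (\<Sum>j<?n. ?g (e j) * pmf (P b) (e j))"
      by (rule sum.reindex_bij_betw[OF e, symmetric])
    finally show ?thesis by (simp add: mult.commute)
  qed
  have "\<forall>j<?n. \<forall>i\<in>{1..K}. \<forall>s\<in>{1..m i}. set_pmf (?p j i s) \<subseteq> A i"
    using set_response[OF ns, OF b] e_in by blast
  moreover have "\<forall>j<?n. 0 \<le> ?w j"
    by simp
  moreover have "\<forall>z\<in>settings K m. \<forall>x\<in>outcomes K A.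
      pmf (star_model K P b z) x = (\<Sum>j<?n. ?w j * (\<Prod>i\<in>{1..K}. pmf (?p j i (z i)) (x i)))"
    using pmf_eq by blast
  ultimately show ?thesis
    unfolding local_dist_def using sum_w
    by - (rule conjI[OF beh], rule exI[of _ ?n], rule exI[of _ ?w], rule exI[of _ ?p], intro conjI)
qed

text \<open>On the axis of party \<open>i\<close> only that party's answer is random once
  \<open>a\<close> is fixed. The law of total probability over the outcomes of the others then
  rebuilds \<open>P z\<close>.\<close>

lemma star_model_eq:
  fixes P :: "'a behaviour"
  assumes ns: "no_signaling K m A P" and b: "b \<in> settings K m" and z: "z \<in> star K m b"
  shows "star_model K P b z = P z"
proof -
  note arb = no_signaling_arb[OF ns]
  consider "z = b" | i s where "i \<in> {1..K}" "s \<in> {1..m i}" "s \<noteq> b i" "z = b(i := s)"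
    using z unfolding star_eq[OF b] by blast
  then show ?thesis
  proof cases
    case 1
    have "star_model K P b z = bind_pmf (P b) return_pmf"
      unfolding star_model_def 1 response_def
    proof (rule bind_pmf_cong[OF refl])
      fix a assume "a \<in> set_pmf (P b)"
      then have "(\<lambda>i. if i \<in> {1..K} then a i else undefined) = a"
        using arb[OF b, of a] by (intro ext) simp
      then show "Pi_pmf {1..K} undefined (\<lambda>i. if b i = b i then return_pmf (a i) else
          map_pmf (\<lambda>x. x i) (cond_pmf (P (b(i := b i)))
            {x. restrict x ({1..K} - {i}) = restrict a ({1..K} - {i})})) = return_pmf a"
        by simp
    qed
    then show ?thesis by (simp add: 1 bind_return_pmf')
  next
    case 2
    let ?I = "{1..K} - {i}"
    let ?r = "\<lambda>x :: 'a outcome. restrict x ?I"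
    have zs: "z \<in> settings K m" using z star_subset by blast
    \<comment> \<open>Given \<open>a\<close>, the others repeat their part of \<open>a\<close> and
      party \<open>i\<close> samples from \<open>P z\<close> conditioned on that part; together this
      is the whole conditional law.\<close>
    have step: "Pi_pmf {1..K} undefined (\<lambda>j. response K P b a j (z j)) = cond_pmf (P z) {x. ?r x = ?r a}"
      if a: "a \<in> set_pmf (P b)" for a
    proof -
      let ?C = "cond_pmf (P z) {x. ?r x = ?r a}"
      have ne: "set_pmf (P z) \<inter> {x. ?r x = ?r a} \<noteq> {}"
        using cond_event_nonempty[OF ns, OF b 2(1,2) a] unfolding 2(4) .
      have "Pi_pmf ?I undefined (\<lambda>j. response K P b a j (z j)) =
          Pi_pmf ?I undefined (\<lambda>j. return_pmf (a j))"
        by (rule Pi_pmf_cong) (auto simp: response_def 2)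
      also have "\<dots> = return_pmf (?r a)"
        by (simp add: restrict_def)
      finally have I: "Pi_pmf ?I undefined (\<lambda>j. response K P b a j (z j)) = return_pmf (?r a)" .
      have "Pi_pmf {1..K} undefined (\<lambda>j. response K P b a j (z j)) =
          Pi_pmf (insert i ?I) undefined (\<lambda>j. response K P b a j (z j))"
        using 2(1) by (simp add: insert_absorb)
      also have "\<dots> = bind_pmf (response K P b a i (z i)) (\<lambda>y. return_pmf ((?r a)(i := y)))"
        by (subst Pi_pmf_insert') (simp_all only: I bind_return_pmf finite_Diff finite_atLeastAtMost, simp)
      also have "\<dots> = map_pmf (\<lambda>x. (?r a)(i := x i)) ?C"
        using 2 by (simp add: response_def map_pmf_def bind_assoc_pmf bind_return_pmf)
      also have "\<dots> = ?C"
      proof (rule map_pmf_idI)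
        fix x assume "x \<in> set_pmf ?C"
        then have x: "x \<in> set_pmf (P z)" "?r x = ?r a" unfolding set_cond_pmf[OF ne] by auto
        show "(?r a)(i := x i) = x"
          unfolding x(2)[symmetric] using arb[OF zs x(1)] by (auto simp: fun_eq_iff)
      qed
      finally show ?thesis .
    qed
    \<comment> \<open>\<open>a\<close> enters only through \<open>?r a\<close>, whose law under
      \<open>P b\<close> is its law under \<open>P z\<close>. Averaging the conditional laws of
      \<open>P z\<close> against it cancels the conditioning.\<close>
    have marg: "map_pmf ?r (P b) = map_pmf ?r (P z)"
      by (rule no_signaling_marginal[OF ns, OF b zs]) (auto simp: 2)
    have "star_model K P b z = bind_pmf (P b) (\<lambda>a. cond_pmf (P z) {x. ?r x = ?r a})"
      unfolding star_model_def by (rule bind_pmf_cong[OF refl step])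
    also have "\<dots> = bind_pmf (map_pmf ?r (P b)) (\<lambda>y. cond_pmf (P z) {x. ?r x = y})"
      by (simp add: bind_map_pmf)
    also have "\<dots> = P z"
      unfolding marg
    proof (rule bind_cond_pmf_cancel)
      fix y assume "y \<in> set_pmf (map_pmf ?r (P z))"
      then show "set_pmf (P z) \<inter> {x. ?r x = y} \<noteq> {}" by auto
    next
      fix x assume "x \<in> set_pmf (P z)"
      then show "set_pmf (map_pmf ?r (P z)) \<inter> {y. ?r x = y} \<noteq> {}" by auto
    next
      fix y x assume "?r x = y"
      then show "measure (P z) {x. ?r x = y} = measure (map_pmf ?r (P z)) {y. ?r x = y}"
        by (auto simp: vimage_def intro!: arg_cong[where f = "measure (P z)"])
    qed
    finally show ?thesis .
  qed
qed

subsection \<open>Attainment of the no-signaling limit\<close>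

lemma finite_outcomes [simp]: "(\<And>i. i \<in> {1..K} \<Longrightarrow> finite (A i)) \<Longrightarrow> finite (outcomes K A)"
  unfolding outcomes_def by (rule finite_PiE) auto

text \<open>Relabelling party by party commutes with restriction to \<open>S\<close>, so equal
  marginals stay equal.\<close>

lemma no_signaling_map:
  assumes ns: "no_signaling K m A P" and c: "\<And>i. i \<in> {1..K} \<Longrightarrow> c i ` A i \<subseteq> B i"
  shows "no_signaling K m B (\<lambda>z. map_pmf (\<lambda>x. \<lambda>i\<in>{1..K}. c i (x i)) (P z))"
proof -
  let ?g = "\<lambda>x. \<lambda>i\<in>{1..K}. c i (x i)"
  have "?g x \<in> outcomes K B" if "z \<in> settings K m" "x \<in> set_pmf (P z)" for z x
    using no_signaling_mem[OF ns, OF that] c by (auto simp: outcomes_def simp del: atLeastAtMost_iff)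
  then have "is_behaviour K m B (\<lambda>z. map_pmf ?g (P z))"
    by (auto simp: is_behaviour_def simp del: atLeastAtMost_iff)
  moreover have "map_pmf (\<lambda>x. restrict x S) (map_pmf ?g (P z)) =
      map_pmf (\<lambda>x. restrict x S) (map_pmf ?g (P z'))"
    if S: "S \<subseteq> {1..K}" and z: "z \<in> settings K m" "z' \<in> settings K m" "\<forall>i\<in>S. z i = z' i" for S z z'
  proof -
    have eq: "restrict (?g x) S = (\<lambda>i\<in>S. c i (restrict x S i))" for x
      using S by (auto simp: fun_eq_iff)
    have "map_pmf (\<lambda>x. restrict x S) (P z) = map_pmf (\<lambda>x. restrict x S) (P z')"
      by (rule no_signaling_marginal[OF ns z(1,2) S]) (use z in blast)
    then have "map_pmf (\<lambda>y. \<lambda>i\<in>S. c i (y i)) (map_pmf (\<lambda>x. restrict x S) (P z)) =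
        map_pmf (\<lambda>y. \<lambda>i\<in>S. c i (y i)) (map_pmf (\<lambda>x. restrict x S) (P z'))"
      by simp
    then show ?thesis by (simp only: map_pmf_comp eq)
  qed
  ultimately show ?thesis unfolding no_signaling_def by blast
qed

lemma no_signaling_mono:
  assumes "no_signaling K m B P" "\<And>i. i \<in> {1..K} \<Longrightarrow> B i \<subseteq> A i"
  shows "no_signaling K m A P"
proof -
  have "outcomes K B \<subseteq> outcomes K A"
    unfolding outcomes_def using assms(2) by (rule PiE_mono)
  then show ?thesis using assms(1) unfolding no_signaling_def is_behaviour_def by blast
qed

lemma no_signaling_const:
  assumes "a \<in> outcomes K A"
  shows "no_signaling K m A (\<lambda>z. return_pmf a)"
  using assms by (simp add: no_signaling_def is_behaviour_def)

section \<open>No-signaling behaviours over finite alphabets as real tables\<close>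

lemma pmf_map_restrict:
  assumes "finite X" "set_pmf p \<subseteq> X"
  shows "pmf (map_pmf (\<lambda>x. restrict x S) p) r = (\<Sum>x\<in>{x \<in> X. restrict x S = r}. pmf p x)"
proof -
  have "pmf (map_pmf (\<lambda>x. restrict x S) p) r = measure p {x \<in> X. restrict x S = r}"
    unfolding pmf_map by (rule measure_pmf.finite_measure_eq_AE)
      (use assms(2) in \<open>auto simp: AE_measure_pmf_iff\<close>)
  then show ?thesis using assms(1) by (simp add: measure_measure_pmf_finite)
qed

text \<open>For finite alphabets this is the no-signaling polytope, with marginals written as the
  sums of \<open>pmf_map_restrict\<close>. Entries off the index set are pinned to 0, so that the
  ambient box is a product of compact sets.\<close>

definition ns_tables :: "nat \<Rightarrow> (nat \<Rightarrow> nat) \<Rightarrow> (nat \<Rightarrow> 'o set) \<Rightarrow> (setting \<times> 'o outcome \<Rightarrow> real) set" where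
  "ns_tables K m B =
     {f. (\<forall>x. f x \<in> (if x \<in> settings K m \<times> outcomes K B then {0..1} else {0})) \<and>
         (\<forall>z\<in>settings K m. (\<Sum>x\<in>outcomes K B. f (z, x)) = 1) \<and>
         (\<forall>S\<in>Pow {1..K}. \<forall>(z, z')\<in>{(z, z'). z \<in> settings K m \<and> z' \<in> settings K m \<and> (\<forall>i\<in>S. z i = z' i)}. \<forall>r.
            (\<Sum>x\<in>{x \<in> outcomes K B. restrict x S = r}. f (z, x)) =
            (\<Sum>x\<in>{x \<in> outcomes K B. restrict x S = r}. f (z', x)))}"

lemma compact_ns_tables: "compact (ns_tables K m B)"
proof -
  let ?box = "\<lambda>x. if x \<in> settings K m \<times> outcomes K B then {0..1} else {0::real}"
  let ?E = "{f. (\<forall>z\<in>settings K m. (\<Sum>x\<in>outcomes K B. f (z, x)) = (1::real)) \<and>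
         (\<forall>S\<in>Pow {1..K}. \<forall>(z, z')\<in>{(z, z'). z \<in> settings K m \<and> z' \<in> settings K m \<and> (\<forall>i\<in>S. z i = z' i)}. \<forall>r.
            (\<Sum>x\<in>{x \<in> outcomes K B. restrict x S = r}. f (z, x)) =
            (\<Sum>x\<in>{x \<in> outcomes K B. restrict x S = r}. f (z', x)))}"
  \<comment> \<open>Tychonoff's theorem for the box of intervals and singletons.\<close>
  have "compactin (product_topology (\<lambda>_. euclidean) UNIV) (PiE UNIV ?box)"
    by (auto simp: compactin_PiE)
  then have "compact (PiE UNIV ?box)"
    by (simp add: euclidean_product_topology)
  \<comment> \<open>Each condition equates sums of coordinate projections, which are continuous in
    the product topology, or compares such a sum with a constant.\<close>
  moreover have "closed ?E"
    unfolding Ball_def split_paired_All case_prod_conv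
    by (intro closed_Collect_conj closed_Collect_all closed_Collect_imp open_Collect_const
        closed_Collect_eq continuous_on_sum continuous_on_product_coordinates continuous_on_const)
  ultimately have "compact (PiE UNIV ?box \<inter> ?E)"
    by (rule compact_Int_closed)
  moreover have "ns_tables K m B = PiE UNIV ?box \<inter> ?E"
    unfolding ns_tables_def PiE_UNIV_domain by (auto simp: Pi_def)
  ultimately show ?thesis by simp
qed

definition table :: "nat \<Rightarrow> (nat \<Rightarrow> nat) \<Rightarrow> 'o behaviour \<Rightarrow> setting \<times> 'o outcome \<Rightarrow> real" where
  "table K m P = (\<lambda>(z, x). if z \<in> settings K m then pmf (P z) x else 0)"

lemma table_in_ns_tables:
  assumes ns: "no_signaling K m B P" and fin: "\<And>i. i \<in> {1..K} \<Longrightarrow> finite (B i)"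
  shows "table K m P \<in> ns_tables K m B"
proof -
  have supp: "set_pmf (P z) \<subseteq> outcomes K B" if "z \<in> settings K m" for z
    using ns that unfolding no_signaling_def is_behaviour_def by blast
  have finO: "finite (outcomes K B)" using fin by (rule finite_outcomes)
  have "table K m P x \<in> (if x \<in> settings K m \<times> outcomes K B then {0..1} else {0})" for x
    using supp by (cases x) (auto simp: table_def pmf_le_1 intro!: pmf_eq_0_set_pmf[THEN iffD2])
  moreover have "(\<Sum>x\<in>outcomes K B. table K m P (z, x)) = 1" if "z \<in> settings K m" for z
    using sum_pmf_eq_1[OF finO supp[OF that]] that by (simp add: table_def)
  moreover have "(\<Sum>x\<in>{x \<in> outcomes K B. restrict x S = r}. table K m P (z, x)) =
      (\<Sum>x\<in>{x \<in> outcomes K B. restrict x S = r}. table K m P (z', x))"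
    if "S \<subseteq> {1..K}" "z \<in> settings K m" "z' \<in> settings K m" "\<forall>i\<in>S. z i = z' i" for S z z' r
    using no_signaling_marginal[OF ns that(2,3,1)] that
    by (simp add: table_def flip: pmf_map_restrict[OF finO supp])
  ultimately show ?thesis unfolding ns_tables_def mem_Collect_eq Pow_iff by blast
qed

text \<open>The maximiser supplied by compactness is only a table. Its rows are nonnegative and sum
  to 1, so \<open>embed_pmf\<close> makes them laws, and the equations between sums become
  equalities of marginals.\<close>

lemma ns_tables_imp_no_signaling:
  assumes f: "f \<in> ns_tables K m B" and fin: "\<And>i. i \<in> {1..K} \<Longrightarrow> finite (B i)"
  obtains P where "no_signaling K m B P" "table K m P = f"
proof
  let ?P = "\<lambda>z. embed_pmf (\<lambda>x. f (z, x))"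
  have finO: "finite (outcomes K B)" using fin by (rule finite_outcomes)
  have box: "f x \<in> (if x \<in> settings K m \<times> outcomes K B then {0..1} else {0})" for x
    using f unfolding ns_tables_def by blast
  then have nonneg: "0 \<le> f x" and out: "x \<notin> settings K m \<times> outcomes K B \<Longrightarrow> f x = 0" for x
    using box[of x] by (cases "x \<in> settings K m \<times> outcomes K B"; simp)+
  have pmf: "pmf (?P z) x = f (z, x)" if z: "z \<in> settings K m" for z x
  proof (rule pmf_embed_pmf)
    have "(\<integral>\<^sup>+x. ennreal (f (z, x)) \<partial>count_space UNIV) = (\<Sum>x\<in>outcomes K B. ennreal (f (z, x)))"
      by (rule nn_integral_count_space'[OF finO]) (use out in auto)
    also have "\<dots> = ennreal (\<Sum>x\<in>outcomes K B. f (z, x))"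
      by (rule sum_ennreal) (rule nonneg)
    also have "\<dots> = 1" using f z by (simp add: ns_tables_def)
    finally show "(\<integral>\<^sup>+x. ennreal (f (z, x)) \<partial>count_space UNIV) = 1" .
  qed (rule nonneg)
  show "table K m ?P = f"
    using pmf out by (auto simp: table_def fun_eq_iff)
  have supp: "set_pmf (?P z) \<subseteq> outcomes K B" if "z \<in> settings K m" for z
  proof
    fix x assume "x \<in> set_pmf (?P z)"
    then show "x \<in> outcomes K B"
      using pmf[OF that, of x] out[of "(z, x)"] by (cases "x \<in> outcomes K B") (auto simp: set_pmf_iff)
  qed
  have "map_pmf (\<lambda>x. restrict x S) (?P z) = map_pmf (\<lambda>x. restrict x S) (?P z')"
    if "S \<subseteq> {1..K}" "z \<in> settings K m" "z' \<in> settings K m" "\<forall>i\<in>S. z i = z' i" for S z z'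
  proof (rule pmf_eqI)
    fix r
    have "(\<Sum>x\<in>{x \<in> outcomes K B. restrict x S = r}. f (z, x)) =
      (\<Sum>x\<in>{x \<in> outcomes K B. restrict x S = r}. f (z', x))"
      using f that unfolding ns_tables_def by blast
    then show "pmf (map_pmf (\<lambda>x. restrict x S) (?P z)) r = pmf (map_pmf (\<lambda>x. restrict x S) (?P z')) r"
      using that by (simp add: pmf_map_restrict[OF finO supp] pmf)
  qed
  then show "no_signaling K m B ?P"
    using supp unfolding no_signaling_def is_behaviour_def by blast
qed

text \<open>The Bell value is linear in the table entries, hence continuous, and constant behaviours
  make the compact set nonempty. The expression keeps the alphabets \<open>A\<close> while
  behaviours range over \<open>B\<close>, because merging compares values taken over
  \<open>A\<close>.\<close>

lemma finite_alphabet_max: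
  assumes fin: "\<And>i. i \<in> {1..K} \<Longrightarrow> finite (B i)" and ne: "\<And>i. i \<in> {1..K} \<Longrightarrow> B i \<noteq> {}"
  shows "\<exists>P. no_signaling K m B P \<and>
    (\<forall>Q. no_signaling K m B Q \<longrightarrow> bell_value K m A \<beta> Q \<le> bell_value K m A \<beta> P)"
proof -
  define v where "v f = (\<Sum>z\<in>settings K m. \<Sum>x\<in>{x \<in> outcomes K A. \<beta> z x \<noteq> 0}. \<beta> z x * f (z, x))"
    for f :: "setting \<times> (nat \<Rightarrow> 'a) \<Rightarrow> real"
  have v: "bell_value K m A \<beta> P = v (table K m P)" for P
    unfolding bell_value_def v_def table_def by simp
  have "continuous_on (ns_tables K m B) v"
    unfolding v_def
    by (intro continuous_on_sum continuous_on_mult continuous_on_const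
        continuous_on_subset[OF continuous_on_product_coordinates subset_UNIV])
  moreover obtain a where "a \<in> outcomes K B"
    using ne by (fastforce simp: outcomes_def PiE_eq_empty_iff)
  then have "ns_tables K m B \<noteq> {}"
    using table_in_ns_tables[OF no_signaling_const[of a K B m] fin] by blast
  ultimately obtain f where f: "f \<in> ns_tables K m B" "\<And>g. g \<in> ns_tables K m B \<Longrightarrow> v g \<le> v f"
    using continuous_attains_sup[OF compact_ns_tables] by metis
  obtain P where "no_signaling K m B P" "table K m P = f"
    using ns_tables_imp_no_signaling[OF f(1) fin] by blast
  then show ?thesis
    using f(2) table_in_ns_tables[OF _ fin] by (auto simp: v)
qed

text \<open>Merging sends every competitor over \<open>A\<close> to one over finite \<open>B\<close>
  with equal value, and the optimum over \<open>B\<close> is itself a behaviour over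
  \<open>A\<close>. Its finite support is what \<open>star_model_local\<close> asks for.\<close>

lemma ns_limit_attained:
  assumes ne: "\<And>i. i \<in> {1..K} \<Longrightarrow> A i \<noteq> {}" and \<beta>: "bell_coeffs K m A \<beta>"
  shows "\<exists>P. no_signaling K m A P \<and> (\<forall>z\<in>settings K m. finite (set_pmf (P z))) \<and>
    (\<forall>Q. no_signaling K m A Q \<longrightarrow> bell_value K m A \<beta> Q \<le> bell_value K m A \<beta> P)"
proof -
  define X where "X = (\<Union>z\<in>settings K m. {x \<in> outcomes K A. \<beta> z x \<noteq> 0})"
  define F where "F i = (\<lambda>x. x i) ` X" for i
  define e where "e i = (SOME a. a \<in> A i \<and> (a \<in> F i \<longrightarrow> A i \<subseteq> F i))" for i
  define c where "c i a = (if a \<in> F i then a else e i)" for i a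
  define B where "B i = insert (e i) (F i)" for i
  \<comment> \<open>The outcomes outside \<open>F i\<close> are merged into \<open>e i\<close>.  If there are none, then \<open>e i\<close> may lie in
    \<open>F i\<close>, but no outcome is then moved.\<close>
  let ?g = "\<lambda>x. \<lambda>i\<in>{1..K}. c i (x i)"
  have "finite X" unfolding X_def using \<beta> by (auto simp: bell_coeffs_def)
  then have finB: "finite (B i)" for i by (simp add: B_def F_def)
  have e: "e i \<in> A i \<and> (e i \<in> F i \<longrightarrow> A i \<subseteq> F i)" if "i \<in> {1..K}" for i
    unfolding e_def by (rule someI_ex) (use ne[OF that] in blast)
  have FA: "F i \<subseteq> A i" if "i \<in> {1..K}" for i
    using that unfolding F_def X_def outcomes_def by blast
  have BA: "B i \<subseteq> A i" if "i \<in> {1..K}" for i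
    using e[OF that] FA[OF that] by (simp add: B_def)
  have cB: "c i ` A i \<subseteq> B i" for i by (auto simp: c_def B_def)
  have fix_X: "?g y = x \<longleftrightarrow> y = x" if x: "x \<in> X" and y: "y \<in> outcomes K A" for x y
  proof -
    have xO: "x \<in> outcomes K A" using x by (auto simp: X_def)
    \<comment> \<open>An outcome \<open>y i\<close> outside \<open>F i\<close> becomes
      \<open>e i\<close>, which cannot be \<open>x i\<close>: were \<open>e i\<close> in
      \<open>F i\<close>, all of \<open>A i\<close> would be, and \<open>y i\<close> with
      it.\<close>
    have "c i (y i) = x i \<longleftrightarrow> y i = x i" if i: "i \<in> {1..K}" for i
    proof -
      have "x i \<in> F i" using x by (simp add: F_def)
      moreover have "y i \<in> A i" using y i unfolding outcomes_def by blast
      ultimately show ?thesis using e[OF i] by (auto simp: c_def)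
    qed
    then have "(\<forall>i\<in>{1..K}. ?g y i = x i) \<longleftrightarrow> (\<forall>i\<in>{1..K}. y i = x i)" by simp
    moreover have "u = x \<longleftrightarrow> (\<forall>i\<in>{1..K}. u i = x i)" if "u \<in> extensional {1..K}" for u
      using that xO extensionalityI[of u "{1..K}" x] unfolding outcomes_def PiE_def by blast
    then have "?g y = x \<longleftrightarrow> (\<forall>i\<in>{1..K}. ?g y i = x i)" "y = x \<longleftrightarrow> (\<forall>i\<in>{1..K}. y i = x i)"
      using y unfolding outcomes_def PiE_def by blast+
    ultimately show ?thesis by blast
  qed
  have value_g: "bell_value K m A \<beta> (\<lambda>z. map_pmf ?g (Q z)) = bell_value K m A \<beta> Q"
    if Q: "no_signaling K m A Q" for Q
    unfolding bell_value_def
  proof (intro sum.cong refl)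
    fix z x assume z: "z \<in> settings K m" and x: "x \<in> {x \<in> outcomes K A. \<beta> z x \<noteq> 0}"
    then have "x \<in> X" by (auto simp: X_def)
    then have "AE y in Q z. y \<in> ?g -` {x} \<longleftrightarrow> y \<in> {x}"
      using fix_X no_signaling_outcomes[OF Q z] by (auto simp: AE_measure_pmf_iff)
    then have "pmf (map_pmf ?g (Q z)) x = pmf (Q z) x"
      unfolding pmf_map unfolding pmf.rep_eq by (rule measure_pmf.finite_measure_eq_AE) auto
    then show "\<beta> z x * pmf (map_pmf ?g (Q z)) x = \<beta> z x * pmf (Q z) x" by simp
  qed
  obtain P where P: "no_signaling K m B P"
    "\<And>Q. no_signaling K m B Q \<Longrightarrow> bell_value K m A \<beta> Q \<le> bell_value K m A \<beta> P"
    using finite_alphabet_max[of K B m A \<beta>] finB by (auto simp: B_def)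
  have "finite (set_pmf (P z))" if "z \<in> settings K m" for z
    by (rule finite_subset[of _ "outcomes K B"])
      (use no_signaling_outcomes[OF P(1) that] finB in auto)
  moreover have "bell_value K m A \<beta> Q \<le> bell_value K m A \<beta> P" if Q: "no_signaling K m A Q" for Q
    using P(2)[OF no_signaling_map[OF Q cB]] value_g[OF Q] by simp
  ultimately show ?thesis
    using no_signaling_mono[OF P(1) BA] by blast
qed

subsection \<open>Sources concentrated on stars\<close>

text \<open>A guessing probability is at most 1. This places the entropy of any given source in the
  range that star sources realise.\<close>

lemma cond_min_entropy_nonneg: "0 \<le> cond_min_entropy J"
proof -
  let ?p = "pmf (map_pmf snd J)"
  let ?t = "\<lambda>l. ?p l * (SUP w. pmf J (w, l) / ?p l)"
  have le: "pmf J (w, l) \<le> ?p l" for w l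
    unfolding pmf_map unfolding pmf.rep_eq by (rule measure_pmf.finite_measure_mono) auto
  \<comment> \<open>Where \<open>?p l = 0\<close>, the quotient is 0 by the convention for
    division.\<close>
  have ratio: "0 \<le> pmf J (w, l) / ?p l" "pmf J (w, l) / ?p l \<le> 1" for w l
    using le[of w l] by (auto simp: divide_le_eq_1 less_le)
  have "(SUP w. pmf J (w, l) / ?p l) \<le> 1" for l
    by (rule cSUP_least) (use ratio in auto)
  then have t_le: "?t l \<le> ?p l" for l
    by (simp add: mult_left_le)
  have "pmf J (undefined, l) / ?p l \<le> (SUP w. pmf J (w, l) / ?p l)" for l
    by (rule cSUP_upper) (use ratio in \<open>auto intro!: bdd_aboveI[of _ 1]\<close>)
  then have "0 \<le> (SUP w. pmf J (w, l) / ?p l)" for l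
    using ratio(1) order_trans by blast
  then have t_nonneg: "0 \<le> ?t l" for l
    by simp
  have "sum ?t F \<le> 1" if "finite F" for F
  proof -
    have "sum ?t F \<le> sum ?p F" by (rule sum_mono) (rule t_le)
    also have "\<dots> \<le> 1"
      using measure_pmf.prob_le_1 by (simp flip: measure_measure_pmf_finite[OF that])
    finally show ?thesis .
  qed
  \<comment> \<open>A family that is not summable has \<open>infsum\<close> 0, so the bound on
    finite partial sums suffices.\<close>
  then have "infsum ?t UNIV \<le> 1"
    using infsum_le_finite_sums[of ?t UNIV 1] infsum_not_exists[of ?t UNIV] by fastforce
  moreover have "0 \<le> infsum ?t UNIV" by (rule infsum_nonneg) (rule t_nonneg)
  \<comment> \<open>The value 0 of the sum is covered by the convention
    \<open>log 2 0 = 0\<close>.\<close>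
  ultimately show ?thesis
    unfolding cond_min_entropy_def
    by (cases "infsum ?t UNIV = 0") (simp_all add: log_def divide_le_0_iff)
qed

section \<open>Sources given by the law of the hidden variable and conditional laws of the
  settings\<close>

definition joint :: "'l pmf \<Rightarrow> ('l \<Rightarrow> 'a pmf) \<Rightarrow> ('a \<times> 'l) pmf" where
  "joint L W = bind_pmf L (\<lambda>l. map_pmf (\<lambda>w. (w, l)) (W l))"

lemma map_snd_joint [simp]: "map_pmf snd (joint L W) = L"
  by (simp add: joint_def map_bind_pmf map_pmf_comp bind_return_pmf')

lemma map_fst_joint [simp]: "map_pmf fst (joint L W) = bind_pmf L W"
  by (simp add: joint_def map_bind_pmf map_pmf_comp)

lemma set_joint: "set_pmf (joint L W) = {(w, l). l \<in> set_pmf L \<and> w \<in> set_pmf (W l)}"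
  by (auto simp: joint_def)

lemma pmf_joint: "pmf (joint L W) (w, l) = pmf L l * pmf (W l) w"
proof -
  have "pmf (map_pmf (\<lambda>w. (w, l')) (W l')) (w, l) = (if l' = l then pmf (W l) w else 0)" for l'
    by (auto simp: pmf_map pmf.rep_eq vimage_def intro!: arg_cong[where f = "measure (W l)"])
  then have "pmf (joint L W) (w, l) = measure_pmf.expectation L (\<lambda>l'. if l' = l then pmf (W l) w else 0)"
    by (simp add: joint_def pmf_bind)
  also have "\<dots> = (\<Sum>l'\<in>{l}. (if l' = l then pmf (W l) w else 0) * pmf L l')"
    by (rule integral_measure_pmf_real) (auto split: if_splits)
  finally show ?thesis by simp
qed

text \<open>The weight \<open>pmf L l\<close> cancels the normalisation where it is positive and
  kills the summand elsewhere, which leaves a finite weighted average of maxima.\<close>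

lemma cond_min_entropy_joint:
  assumes "finite (set_pmf L)"
  shows "cond_min_entropy (joint L W) =
    - log 2 (measure_pmf.expectation L (\<lambda>l. SUP w. pmf (W l) w))"
proof -
  let ?t = "\<lambda>l. pmf L l * (SUP w. pmf (joint L W) (w, l) / pmf L l)"
  have "infsum ?t UNIV = infsum (\<lambda>l. (SUP w. pmf (W l) w) * pmf L l) (set_pmf L)"
    by (rule infsum_cong_neutral) (auto simp: pmf_joint set_pmf_iff)
  also have "\<dots> = measure_pmf.expectation L (\<lambda>l. SUP w. pmf (W l) w)"
    using assms by (simp add: integral_measure_pmf_real[of "set_pmf L"])
  finally show ?thesis by (simp add: cond_min_entropy_def)
qed

lemma SUP_pmf_of_set:
  assumes "finite A" "A \<noteq> {}"
  shows "(SUP w. pmf (pmf_of_set A) w) = 1 / card A"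
proof (rule antisym)
  show "(SUP w. pmf (pmf_of_set A) w) \<le> 1 / card A"
    by (rule cSUP_least) (use assms in \<open>auto simp: indicator_def\<close>)
  obtain a where a: "a \<in> A" using assms by auto
  have "bdd_above (range (pmf (pmf_of_set A)))"
    by (rule bdd_aboveI[of _ 1]) (auto intro: pmf_le_1)
  then have "pmf (pmf_of_set A) a \<le> (SUP w. pmf (pmf_of_set A) w)"
    by (intro cSUP_upper) auto
  then show "1 / card A \<le> (SUP w. pmf (pmf_of_set A) w)"
    using a assms by simp
qed

lemma SUP_return_pmf: "(SUP w. pmf (return_pmf a) w) = 1"
  using SUP_pmf_of_set[of "{a}"] by (simp add: pmf_of_set_singleton)

text \<open>Double counting: by symmetry the \<open>t\<close> with \<open>w\<close> in
  \<open>S t\<close> are exactly the elements of \<open>S w\<close>, so \<open>w\<close> receives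
  \<open>k\<close> shares of size \<open>1 / k\<close>. In other words, a random step on a regular
  undirected graph preserves the uniform law.\<close>

lemma bind_pmf_of_set_uniform:
  assumes T: "finite T" "T \<noteq> {}" and S: "\<And>t. t \<in> T \<Longrightarrow> S t \<subseteq> T" "\<And>t. t \<in> T \<Longrightarrow> S t \<noteq> {}"
    and card: "\<And>t. t \<in> T \<Longrightarrow> card (S t) = k"
    and sym: "\<And>t u. t \<in> T \<Longrightarrow> u \<in> S t \<Longrightarrow> t \<in> S u"
  shows "bind_pmf (pmf_of_set T) (\<lambda>t. pmf_of_set (S t)) = pmf_of_set T"
proof (rule pmf_eqI)
  fix w
  have fin: "finite (S t)" if "t \<in> T" for t using S(1)[OF that] T(1) by (rule finite_subset)
  have "(\<Sum>t\<in>T. pmf (pmf_of_set (S t)) w) = (\<Sum>t\<in>T. indicator (S t) w / k)"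
    by (rule sum.cong) (use S fin card in auto)
  also have "\<dots> = (if w \<in> T then 1 else 0)"
  proof (cases "w \<in> T")
    case True
    then have "(\<Sum>t\<in>T. indicator (S t) w / real k) = (\<Sum>t\<in>S w. 1 / real k)"
      using T S sym by (intro sum.mono_neutral_cong_right) (auto simp: indicator_def)
    also have "\<dots> = 1" using card[OF True] S(2)[OF True] fin[OF True] by (auto simp: card_eq_0_iff)
    finally show ?thesis using True by simp
  next
    case False
    then show ?thesis using S(1) by (auto simp: indicator_def subset_iff intro!: sum.neutral)
  qed
  finally show "pmf (bind_pmf (pmf_of_set T) (\<lambda>t. pmf_of_set (S t))) w = pmf (pmf_of_set T) w"
    using T by (simp add: pmf_bind_pmf_of_set indicator_def)
qed

section \<open>Products of stars over the runs\<close>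

definition runs :: "nat \<Rightarrow> (nat \<Rightarrow> nat) \<Rightarrow> nat \<Rightarrow> (nat \<Rightarrow> setting) set" where
  "runs K m N = (\<Pi>\<^sub>E n\<in>{1..N}. settings K m)"

definition stars :: "nat \<Rightarrow> (nat \<Rightarrow> nat) \<Rightarrow> nat \<Rightarrow> (nat \<Rightarrow> setting) \<Rightarrow> (nat \<Rightarrow> setting) set" where
  "stars K m N t = (\<Pi>\<^sub>E n\<in>{1..N}. star K m (t n))"

lemma finite_runs [simp]: "finite (runs K m N)"
  by (simp add: runs_def finite_PiE)

lemma settings_nonempty:
  assumes "\<forall>k\<in>{1..K}. 1 < m k"
  shows "settings K m \<noteq> {}"
proof -
  have "{1..m i} \<noteq> {}" if "i \<in> {1..K}" for i
    using bspec[OF assms that] by simp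
  then show ?thesis unfolding settings_def PiE_eq_empty_iff by blast
qed

lemma runs_nonempty:
  assumes "\<forall>k\<in>{1..K}. 1 < m k"
  shows "runs K m N \<noteq> {}"
  using settings_nonempty[OF assms] by (simp add: runs_def PiE_eq_empty_iff)

lemma card_runs: "real (card (runs K m N)) = (\<Prod>k=1..K. real (m k)) ^ N"
  by (simp add: runs_def settings_def card_PiE)

lemma stars_subset: "stars K m N t \<subseteq> runs K m N"
  unfolding stars_def runs_def by (rule PiE_mono) (rule star_subset)

lemma runs_settings: "t \<in> runs K m N \<Longrightarrow> n \<in> {1..N} \<Longrightarrow> t n \<in> settings K m"
  unfolding runs_def by (rule PiE_mem)

lemma self_in_stars: "t \<in> runs K m N \<Longrightarrow> t \<in> stars K m N t"
  unfolding runs_def stars_def PiE_iff using self_in_star by blast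

lemma stars_nonempty: "t \<in> runs K m N \<Longrightarrow> stars K m N t \<noteq> {}"
  using self_in_stars by blast

lemma finite_stars [simp]: "finite (stars K m N t)"
  by (rule finite_subset[OF stars_subset finite_runs])

lemma stars_sym:
  assumes "t \<in> runs K m N" "u \<in> stars K m N t"
  shows "t \<in> stars K m N u"
  using assms star_sym unfolding runs_def stars_def PiE_iff by metis

lemma card_stars:
  assumes "t \<in> runs K m N"
  shows "card (stars K m N t) = (1 + (\<Sum>i=1..K. m i - 1)) ^ N"
  using card_star[OF runs_settings[OF assms]] by (simp add: stars_def card_PiE)

text \<open>The values of \<open>\<Lambda>\<close> before they are coded as naturals: a flag telling
  whether the settings leak, and a base setting for every run.\<close>

abbreviation hidden :: "nat \<Rightarrow> (nat \<Rightarrow> nat) \<Rightarrow> nat \<Rightarrow> (bool \<times> (nat \<Rightarrow> setting)) set" where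
  "hidden K m N \<equiv> UNIV \<times> runs K m N"

text \<open>\<open>from_nat_into\<close> lands in the nonempty set at every number, even at one that
  is not a code. This matters because the responses have to be local for all
  \<open>l\<close>.\<close>

lemma hidden_value:
  assumes m: "\<forall>k\<in>{1..K}. 1 < m k"
  shows "snd (from_nat_into (hidden K m N) l) \<in> runs K m N"
proof -
  have "from_nat_into (hidden K m N) l \<in> hidden K m N"
    by (rule from_nat_into) (use runs_nonempty[OF m] in auto)
  then show ?thesis by auto
qed

text \<open>A single coin of bias \<open>q\<close> decides the leak for all runs together. The bias
  tunes the conditional min-entropy while the observed law stays fixed.\<close>

definition star_source :: "nat \<Rightarrow> (nat \<Rightarrow> nat) \<Rightarrow> nat \<Rightarrow> real \<Rightarrow> nat source" where
  "star_source K m N q =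
     joint (map_pmf (to_nat_on (hidden K m N))
              (pair_pmf (bernoulli_pmf q) (pmf_of_set (runs K m N))))
       (\<lambda>l. case from_nat_into (hidden K m N) l of
          (leak, t) \<Rightarrow> if leak then return_pmf t else pmf_of_set (stars K m N t))"

text \<open>A leaked tuple lies in its own product of stars, so one rule for the responses serves
  both branches.\<close>

lemma star_source_support:
  assumes m: "\<forall>k\<in>{1..K}. 1 < m k" and wl: "(w, l) \<in> set_pmf (star_source K m N q)"
  shows "w \<in> stars K m N (snd (from_nat_into (hidden K m N) l))"
proof -
  obtain leak t where lt: "from_nat_into (hidden K m N) l = (leak, t)" by fastforce
  have t: "t \<in> runs K m N" using hidden_value[OF m, of N l] by (simp add: lt)
  have "w \<in> set_pmf (if leak then return_pmf t else pmf_of_set (stars K m N t))"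
    using wl unfolding star_source_def set_joint by (simp add: lt)
  then show ?thesis
    using self_in_stars[OF t] stars_nonempty[OF t] by (cases leak) (simp_all add: lt)
qed

text \<open>Both branches leave the settings uniform: a leaked \<open>t\<close> is uniform itself,
  and moving to a uniform member of \<open>stars K m N t\<close> preserves uniformity.\<close>

lemma map_fst_star_source:
  assumes m: "\<forall>k\<in>{1..K}. 1 < m k"
  shows "map_pmf fst (star_source K m N q) = pmf_of_set (runs K m N)"
proof -
  let ?T = "runs K m N"
  have "map_pmf fst (star_source K m N q) =
    bind_pmf (pair_pmf (bernoulli_pmf q) (pmf_of_set ?T))
      (\<lambda>(leak, t). if leak then return_pmf t else pmf_of_set (stars K m N t))"
    unfolding star_source_def map_fst_joint bind_map_pmf
  proof (rule bind_pmf_cong[OF refl])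
    fix x assume "x \<in> set_pmf (pair_pmf (bernoulli_pmf q) (pmf_of_set ?T))"
    then have "x \<in> hidden K m N" using runs_nonempty[OF m] by auto
    then have "from_nat_into (hidden K m N) (to_nat_on (hidden K m N) x) = x"
      by (intro from_nat_into_to_nat_on countable_finite) simp_all
    then show "(case from_nat_into (hidden K m N) (to_nat_on (hidden K m N) x) of
        (leak, t) \<Rightarrow> if leak then return_pmf t else pmf_of_set (stars K m N t)) =
        (case x of (leak, t) \<Rightarrow> if leak then return_pmf t else pmf_of_set (stars K m N t))"
      by simp
  qed
  also have "\<dots> = bind_pmf (bernoulli_pmf q) (\<lambda>leak. bind_pmf (pmf_of_set ?T)
      (\<lambda>t. if leak then return_pmf t else pmf_of_set (stars K m N t)))"
    by (simp add: pair_pmf_def bind_assoc_pmf bind_return_pmf)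
  also have "\<dots> = bind_pmf (bernoulli_pmf q) (\<lambda>leak. pmf_of_set ?T)"
  proof (rule bind_pmf_cong[OF refl])
    fix leak
    have "bind_pmf (pmf_of_set ?T) (\<lambda>t. pmf_of_set (stars K m N t)) = pmf_of_set ?T"
      by (rule bind_pmf_of_set_uniform[OF finite_runs runs_nonempty[OF m] stars_subset stars_nonempty
            card_stars stars_sym])
    then show "bind_pmf (pmf_of_set ?T)
        (\<lambda>t. if leak then return_pmf t else pmf_of_set (stars K m N t)) = pmf_of_set ?T"
      by (cases leak) (simp_all add: bind_return_pmf')
  qed
  finally show ?thesis by simp
qed

lemma min_entropy_star_source:
  assumes m: "\<forall>k\<in>{1..K}. 1 < m k"
  shows "min_entropy (map_pmf fst (star_source K m N q)) = real N * log 2 (\<Prod>k=1..K. real (m k))"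
proof -
  have "0 < real (m k)" if "k \<in> {1..K}" for k
    using bspec[OF m that] by simp
  then have "0 < (\<Prod>k=1..K. real (m k))" by (rule prod_pos)
  then show ?thesis
    unfolding map_fst_star_source[OF m] min_entropy_def SUP_pmf_of_set[OF finite_runs runs_nonempty[OF m]]
    unfolding card_runs log_recip by (simp only: log_nat_power minus_minus)
qed

text \<open>Knowing \<open>\<Lambda>\<close>, one guesses the settings with certainty if they leak,
  and otherwise with probability one over the size of the product of stars. The coin averages the
  two.\<close>

lemma cond_min_entropy_star_source:
  assumes m: "\<forall>k\<in>{1..K}. 1 < m k" and q: "0 \<le> q" "q \<le> 1"
  shows "cond_min_entropy (star_source K m N q) =
    - log 2 (q + (1 - q) / (1 + (\<Sum>i=1..K. real (m i) - 1)) ^ N)"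
proof -
  let ?X = "hidden K m N"
  let ?S = "1 + (\<Sum>i=1..K. real (m i) - 1)"
  let ?L = "pair_pmf (bernoulli_pmf q) (pmf_of_set (runs K m N))"
  let ?W = "\<lambda>(leak, t). if leak then return_pmf t else pmf_of_set (stars K m N t)"
  let ?M = "\<lambda>leak. if leak then 1 else 1 / ?S ^ N"
  have supp: "set_pmf ?L \<subseteq> ?X" using runs_nonempty[OF m] by auto
  have finL: "finite (set_pmf ?L)" using supp by (rule finite_subset) simp
  \<comment> \<open>Since every \<open>m i\<close> exceeds 1, truncated subtraction agrees with
    subtraction of reals.\<close>
  have S: "real (1 + (\<Sum>i=1..K. m i - 1)) = ?S"
    using m by (auto intro!: sum.cong simp: of_nat_diff)
  have sup: "(SUP w. pmf (?W x) w) = ?M (fst x)" if x: "x \<in> ?X" for x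
  proof -
    obtain leak t where lt: "x = (leak, t)" "t \<in> runs K m N" using x by auto
    have "(SUP w. pmf (pmf_of_set (stars K m N t)) w) = 1 / ?S ^ N"
      unfolding SUP_pmf_of_set[OF finite_stars stars_nonempty[OF lt(2)]] card_stars[OF lt(2)] of_nat_power S ..
    then show ?thesis by (simp add: lt SUP_return_pmf del: pmf_return)
  qed
  have "measure_pmf.expectation (map_pmf (to_nat_on ?X) ?L) (\<lambda>l. SUP w. pmf (?W (from_nat_into ?X l)) w)
      = measure_pmf.expectation ?L (\<lambda>x. ?M (fst x))"
    unfolding integral_map_pmf
  proof (rule integral_cong_AE)
    show "AE x in ?L. (SUP w. pmf (?W (from_nat_into ?X (to_nat_on ?X x))) w) = ?M (fst x)"
    proof (rule AE_pmfI)
      fix x assume "x \<in> set_pmf ?L"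
      then have x: "x \<in> ?X" using supp by blast
      have "from_nat_into ?X (to_nat_on ?X x) = x"
        using x by (intro from_nat_into_to_nat_on countable_finite) auto
      then show "(SUP w. pmf (?W (from_nat_into ?X (to_nat_on ?X x))) w) = ?M (fst x)"
        using sup[OF x] by simp
    qed
  qed simp_all
  also have "\<dots> = measure_pmf.expectation (map_pmf fst ?L) ?M"
    by simp
  also have "\<dots> = q + (1 - q) / ?S ^ N"
    using q by (simp add: map_fst_pair_pmf)
  finally show ?thesis
    unfolding star_source_def
    by (subst cond_min_entropy_joint) (use finL in \<open>simp_all only: set_map_pmf finite_imageI\<close>)
qed

text \<open>The guessing probability moves affinely from its leak-free value \<open>c\<close> to 1
  as \<open>q\<close> goes from 0 to 1, so it takes the value \<open>2 powr - h\<close>.\<close>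

lemma star_source_entropy_range:
  assumes m: "\<forall>k\<in>{1..K}. 1 < m k"
    and h: "0 \<le> h" "h \<le> real N * log 2 (1 + (\<Sum>i=1..K. real (m i) - 1))"
  shows "\<exists>q. cond_min_entropy (star_source K m N q) = h"
proof -
  let ?S = "1 + (\<Sum>i=1..K. real (m i) - 1)"
  have "0 \<le> (\<Sum>i=1..K. real (m i) - 1)" using m by (intro sum_nonneg) fastforce
  then have S: "1 \<le> ?S" by simp
  define c where "c = 1 / ?S ^ N"
  have c: "0 < c" "c \<le> 1" using S by (auto simp: c_def one_le_power)
  have "2 powr (log 2 ?S * real N) = (2 powr log 2 ?S) powr real N"
    by (rule powr_powr[symmetric])
  also have "\<dots> = ?S ^ N"
    using S by (simp add: powr_realpow)
  finally have "?S ^ N = 2 powr (real N * log 2 ?S)"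
    by (simp only: mult.commute)
  then have "2 powr h \<le> ?S ^ N" using h by simp
  then have ch: "c \<le> 2 powr - h"
    unfolding c_def powr_minus_divide using S by (intro divide_left_mono mult_pos_pos) auto
  have h1: "2 powr - h \<le> 1" using h powr_mono[of "- h" 0 2] by simp
  obtain q where q: "0 \<le> q" "q \<le> 1" "q + (1 - q) * c = 2 powr - h"
  proof (cases "c = 1")
    \<comment> \<open>The equation for \<open>q\<close> degenerates without runs or without parties.
      Then \<open>2 powr - h = 1\<close> and any \<open>q\<close> solves it.\<close>
    case True
    then show ?thesis using that[of 0] ch h1 by simp
  next
    case False
    with c have c1: "0 < 1 - c" by simp
    define q where "q = (2 powr - h - c) / (1 - c)"
    have "q * (1 - c) = 2 powr - h - c" using c1 by (simp add: q_def)
    then have "q + (1 - q) * c = 2 powr - h" by (simp add: algebra_simps)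
    then show ?thesis
      using that[of q] ch h1 c1 by (simp add: q_def)
  qed
  have "cond_min_entropy (star_source K m N q) = - log 2 (2 powr - h)"
    unfolding cond_min_entropy_star_source[OF m q(1,2)] q(3)[symmetric] by (simp add: c_def)
  also have "\<dots> = h" by (simp add: log_powr_cancel)
  finally show ?thesis by blast
qed

subsection \<open>Reaching the no-signaling limit\<close>

lemma bell_value_cong:
  assumes "\<And>z. z \<in> settings K m \<Longrightarrow> P z = Q z"
  shows "bell_value K m A \<beta> P = bell_value K m A \<beta> Q"
  unfolding bell_value_def using assms by simp

text \<open>The observed law is uniform on all tuples, so each setting occurs in each run. The
  conditioning in \<open>observed\<close> is therefore meaningful.\<close>

lemma star_source_fst_event:
  assumes m: "\<forall>k\<in>{1..K}. 1 < m k" and n: "n \<in> {1..N}" and z: "z \<in> settings K m"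
  shows "set_pmf (star_source K m N q) \<inter> {x. fst x n = z} \<noteq> {}"
proof -
  obtain t where t: "t \<in> runs K m N" using runs_nonempty[OF m] by blast
  then have "t(n := z) \<in> runs K m N"
    using n z unfolding runs_def by (auto simp: PiE_def Pi_def extensional_def)
  then have "t(n := z) \<in> set_pmf (map_pmf fst (star_source K m N q))"
    by (simp add: map_fst_star_source[OF m] runs_nonempty[OF m])
  then show ?thesis by fastforce
qed

text \<open>Given the setting \<open>z\<close> in run \<open>n\<close>, every value of
  \<open>\<Lambda>\<close> still possible has \<open>z\<close> in the star of its base setting for
  that run, where the local model reproduces \<open>P z\<close>. Averaging over these values changes
  nothing.\<close>

lemma ns_limit_locally_reached:
  assumes m: "\<forall>k\<in>{1..K}. 1 < m k" and n: "n \<in> {1..N}"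
    and ns: "no_signaling K m A P" and fin: "\<forall>z\<in>settings K m. finite (set_pmf (P z))"
  shows "locally_reached K m A \<beta> (star_source K m N q) n (bell_value K m A \<beta> P)"
proof -
  define base where "base l = snd (from_nat_into (hidden K m N) l) n" for l
  let ?R = "\<lambda>l. star_model K P (base l)"
  let ?J = "star_source K m N q"
  have base: "base l \<in> settings K m" for l
    unfolding base_def by (rule runs_settings[OF hidden_value[OF m] n])
  have "local_dist K m A (?R l)" for l
    using star_model_local[OF ns base] fin base by blast
  moreover have "observed ?J n ?R z = P z" if z: "z \<in> settings K m" for z
  proof -
    have "?R l z = P z" if l: "l \<in> set_pmf (map_pmf snd (cond_pmf ?J {x. fst x n = z}))" for l
    proof -
      obtain w where w: "(w, l) \<in> set_pmf ?J" "w n = z"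
        using l unfolding set_map_pmf set_cond_pmf[OF star_source_fst_event[OF m n z]] by auto
      have "w n \<in> star K m (base l)"
        using star_source_support[OF m w(1)] n unfolding stars_def base_def by (rule PiE_mem)
      then show ?thesis using star_model_eq[OF ns base] w(2) by blast
    qed
    then have "observed ?J n ?R z = bind_pmf (map_pmf snd (cond_pmf ?J {x. fst x n = z})) (\<lambda>l. P z)"
      unfolding observed_def by (intro bind_pmf_cong refl)
    then show ?thesis by simp
  qed
  then have "bell_value K m A \<beta> (observed ?J n ?R) = bell_value K m A \<beta> P"
    by (rule bell_value_cong)
  ultimately show ?thesis
    unfolding locally_reached_def by (intro exI[of _ ?R]) simp
qed

section \<open>Conclusion for all Bell expressions and all admissible entropies\<close>

lemma is_source_star_source:
  assumes m: "\<forall>k\<in>{1..K}. 1 < m k"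
  shows "is_source K m N (star_source K m N q)"
  unfolding is_source_def map_fst_star_source[OF m] set_pmf_of_set[OF runs_nonempty[OF m] finite_runs]
  unfolding runs_def ..

text \<open>The source is fixed by \<open>K\<close>, \<open>m\<close>, \<open>N\<close> and
  \<open>h\<close> before alphabets and Bell expression are chosen; only the optimal behaviour and
  the responses depend on these.\<close>

lemma no_conclusion_star:
  assumes m: "\<forall>k\<in>{1..K}. 1 < m k"
    and h: "0 \<le> h" "h \<le> real N * log 2 (1 + (\<Sum>k=1..K. real (m k) - 1))"
  shows "no_conclusion K m N TYPE('o) (real N * log 2 (\<Prod>k=1..K. real (m k))) h"
proof -
  obtain q where q: "cond_min_entropy (star_source K m N q) = h"
    using star_source_entropy_range[OF m h] by blast
  have "\<exists>v. is_ns_limit K m A \<beta> v \<and> (\<forall>n\<in>{1..N}. locally_reached K m A \<beta> (star_source K m N q) n v)"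
    if A: "\<forall>i\<in>{1..K}. A i \<noteq> {}" and \<beta>: "bell_coeffs K m A \<beta>"
    for A :: "nat \<Rightarrow> 'o set" and \<beta>
  proof -
    obtain P where P: "no_signaling K m A P" "\<forall>z\<in>settings K m. finite (set_pmf (P z))"
      "\<forall>Q. no_signaling K m A Q \<longrightarrow> bell_value K m A \<beta> Q \<le> bell_value K m A \<beta> P"
      using ns_limit_attained[OF _ \<beta>] A by blast
    have "is_ns_limit K m A \<beta> (bell_value K m A \<beta> P)"
      unfolding is_ns_limit_def using P by blast
    then show ?thesis
      using ns_limit_locally_reached[OF m _ P(1,2)] by blast
  qed
  then show ?thesis
    unfolding no_conclusion_def
    using is_source_star_source[OF m, of N q] min_entropy_star_source[OF m, of N q] q by blast
qed

theorem theorem1: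
  shows
    "(\<forall>(mA::nat) (mB::nat) (N::nat) (XY :: 'l source).
        1 < mA \<and> 1 < mB \<and> is_source 2 (bipartite mA mB) N XY \<and>
        min_entropy (map_pmf fst XY) = real N * log 2 (real mA * real mB) \<and>
        cond_min_entropy XY \<le> real N * log 2 (real mA + real mB - 1) \<longrightarrow>
        no_conclusion 2 (bipartite mA mB) N TYPE('o)
          (min_entropy (map_pmf fst XY)) (cond_min_entropy XY))
   \<and> (\<forall>(K::nat) (m :: nat \<Rightarrow> nat) (N::nat) (Z :: 'l source).
        (\<forall>k\<in>{1..K}. 1 < m k) \<and> is_source K m N Z \<and>
        min_entropy (map_pmf fst Z) = real N * log 2 (\<Prod>k=1..K. real (m k)) \<and>
        cond_min_entropy Z \<le> real N * log 2 ((\<Sum>k=1..K. real (m k)) - real K + 1) \<longrightarrow>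
        no_conclusion K m N TYPE('o)
          (min_entropy (map_pmf fst Z)) (cond_min_entropy Z))
   \<and> (\<forall>(K::nat) (m :: nat \<Rightarrow> nat) (N::nat) (Z :: 'l source).
        2 \<le> K \<and> (\<forall>k\<in>{1..K}. 1 < m k) \<and> is_source K m N Z \<and>
        cond_min_entropy Z \<le> real N * log 2 3 \<longrightarrow>
        no_conclusion K m N TYPE('o)
          (real N * log 2 (\<Prod>k=1..K. real (m k))) (cond_min_entropy Z))"
proof (intro conjI allI impI; elim conjE)
  fix mA mB N :: nat and XY :: "'l source"
  assume mAB: "1 < mA" "1 < mB"
    and obs: "min_entropy (map_pmf fst XY) = real N * log 2 (real mA * real mB)"
    and le: "cond_min_entropy XY \<le> real N * log 2 (real mA + real mB - 1)"
  have two: "{1..2} = {1, 2::nat}" by auto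
  have m: "\<forall>k\<in>{1..2}. 1 < bipartite mA mB k"
    using mAB by (simp add: bipartite_def)
  have sum: "1 + (\<Sum>k=1..2. real (bipartite mA mB k) - 1) = real mA + real mB - 1"
    unfolding two by (simp add: bipartite_def)
  have prod: "(\<Prod>k=1..2. real (bipartite mA mB k)) = real mA * real mB"
    unfolding two by (simp add: bipartite_def)
  \<comment> \<open>The given source contributes only its two entropies; the witness is a star
    source with the same ones.\<close>
  show "no_conclusion 2 (bipartite mA mB) N TYPE('o)
      (min_entropy (map_pmf fst XY)) (cond_min_entropy XY)"
    using no_conclusion_star[OF m cond_min_entropy_nonneg, of XY N] le
    unfolding obs sum prod by blast
next
  fix K N :: nat and m :: "nat \<Rightarrow> nat" and Z :: "'l source"
  assume m: "\<forall>k\<in>{1..K}. 1 < m k"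
    and obs: "min_entropy (map_pmf fst Z) = real N * log 2 (\<Prod>k=1..K. real (m k))"
    and le: "cond_min_entropy Z \<le> real N * log 2 ((\<Sum>k=1..K. real (m k)) - real K + 1)"
  have eq: "(\<Sum>k=1..K. real (m k)) - real K + 1 = 1 + (\<Sum>k=1..K. real (m k) - 1)"
    by (simp add: sum_subtractf)
  show "no_conclusion K m N TYPE('o) (min_entropy (map_pmf fst Z)) (cond_min_entropy Z)"
    unfolding obs by (rule no_conclusion_star[OF m cond_min_entropy_nonneg le[unfolded eq]])
next
  fix K N :: nat and m :: "nat \<Rightarrow> nat" and Z :: "'l source"
  assume K: "2 \<le> K" and m: "\<forall>k\<in>{1..K}. 1 < m k"
    and le: "cond_min_entropy Z \<le> real N * log 2 3"
  \<comment> \<open>Every party adds at least one setting to a star besides the base, so two parties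
    already give three.\<close>
  have "real (card {1..K}) \<le> (\<Sum>k=1..K. real (m k) - 1)"
    using m sum_mono[of "{1..K}" "\<lambda>_. 1 :: real" "\<lambda>k. real (m k) - 1"] by fastforce
  then have "3 \<le> 1 + (\<Sum>k=1..K. real (m k) - 1)" using K by simp
  then have "real N * log 2 3 \<le> real N * log 2 (1 + (\<Sum>k=1..K. real (m k) - 1))"
    by (intro mult_left_mono) auto
  with le have "cond_min_entropy Z \<le> real N * log 2 (1 + (\<Sum>k=1..K. real (m k) - 1))"
    by (rule order_trans)
  then show "no_conclusion K m N TYPE('o)
      (real N * log 2 (\<Prod>k=1..K. real (m k))) (cond_min_entropy Z)"
    by (rule no_conclusion_star[OF m cond_min_entropy_nonneg])
qed

end
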